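(* For the distributed spectrum access algorithm with a finite parameter $\theta>0$, let $\Phi_\theta=\sum_{\boldsymbol a\in\Omega}q^*_{\boldsymbol a}\Phi(\boldsymbol a)$ be the expected potential under its stationary distribution $q^*_{\boldsymbol a}=\exp(\theta\Phi(\boldsymbol a))/\sum_{\hat{\boldsymbol a}\in\Omega}\exp(\theta\Phi(\hat{\boldsymbol a}))$, and let $\Phi^*=\max_{\boldsymbol a\in\Omega}\Phi(\boldsymbol a)$. Then $$0\le\Phi^*-\Phi_\theta\le\frac1\theta\sum_{n=1}^N\ln|\mathcal M_n|.$$
   Context: Users: $\mathcal N=\{1,\dots,N\}$. User $n$ chooses a channel $a_n$ from a nonempty finite set $\mathcal M_n$ of vacant channels; $\boldsymbol a\in\Omega=\prod_n\mathcal M_n$. $P_m>0$ is the transmission power of user $m$, $d_{mn}=d_{nm}>0$ is the distance between $m\ne n$, $\alpha>0$ is the path loss factor, $\omega^n_a\in\mathbb R$ is the noise power of user $n$ on channel $a$, and $I_{\{\cdot\}}$ is the indicator. Physical and social graphs on $\mathcal N$ (no loops) have neighbour sets $\mathcal N_n^p$ and $\mathcal N_n^s$; $\mathcal N_n^{sp}=\mathcal N_n^p\cap\mathcal N_n^s$; social ties have strengths $w_{nm}\in[0,1]$. Standing assumptions: equal powers ($P_n=P_m$), both graphs undirected, $w_{nm}=w_{mn}$. Potential function: $$\Phi(\boldsymbol a)=-\frac12\sum_{n}\sum_{m\in\mathcal N_n^p}P_m d_{mn}^{-\alpha}I_{\{a_n=a_m\}}-\sum_n\omega^n_{a_n}-\frac12\sum_n\sum_{m\in\mathcal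 N_n^{sp}}w_{nm}P_m d_{mn}^{-\alpha}I_{\{a_n=a_m\}}.$$ The distributed spectrum access algorithm with parameter $\theta$ is a randomized channel-update procedure that induces a Markov chain on $\Omega$ with stationary distribution $\boldsymbol q^*$; it enters the statement only through $\boldsymbol q^*$. *)

theory Defs
  imports "HOL-Analysis.Analysis"
begin

definition users :: "nat \<Rightarrow> nat set" where
  "users N = {1..N}"

definition profiles :: "nat \<Rightarrow> (nat \<Rightarrow> 'c set) \<Rightarrow> (nat \<Rightarrow> 'c) set" where
  "profiles N M = (\<Pi>\<^sub>E n\<in>users N. M n)"

text \<open>A loop-free undirected graph on a vertex set, given by its neighbour sets.\<close>

definition undirected_graph :: "'v set \<Rightarrow> ('v \<Rightarrow> 'v set) \<Rightarrow> bool" where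
  "undirected_graph V nbr \<longleftrightarrow>
     (\<forall>n\<in>V. nbr n \<subseteq> V \<and> n \<notin> nbr n) \<and>
     (\<forall>n\<in>V. \<forall>m\<in>V. m \<in> nbr n \<longleftrightarrow> n \<in> nbr m)"

text \<open>
  The arguments \<open>Np\<close> and \<open>Ns\<close> are the neighbour sets of the physical and the social graph,
  \<open>\<omega> n c\<close> is the noise power of user \<open>n\<close> on channel \<open>c\<close>.
\<close>

definition potential ::
  "nat \<Rightarrow> (nat \<Rightarrow> real) \<Rightarrow> (nat \<Rightarrow> nat \<Rightarrow> real) \<Rightarrow> real \<Rightarrow> (nat \<Rightarrow> 'c \<Rightarrow> real) \<Rightarrow>
   (nat \<Rightarrow> nat set) \<Rightarrow> (nat \<Rightarrow> nat set) \<Rightarrow> (nat \<Rightarrow> nat \<Rightarrow> real) \<Rightarrow> (nat \<Rightarrow> 'c) \<Rightarrow> real" where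
  "potential N P d \<alpha> \<omega> Np Ns w a =
     - (1/2) * (\<Sum>n\<in>users N. \<Sum>m\<in>Np n. P m * d m n powr (-\<alpha>) * of_bool (a n = a m))
     - (\<Sum>n\<in>users N. \<omega> n (a n))
     - (1/2) * (\<Sum>n\<in>users N. \<Sum>m\<in>Np n \<inter> Ns n.
                  w n m * P m * d m n powr (-\<alpha>) * of_bool (a n = a m))"

text \<open>
  The stationary distribution of the spectrum access algorithm with parameter \<open>\<theta>\<close> on the
  finite state space \<open>\<Omega>\<close>.
\<close>

definition stationary_dist :: "'s set \<Rightarrow> real \<Rightarrow> ('s \<Rightarrow> real) \<Rightarrow> 's \<Rightarrow> real" where
  "stationary_dist \<Omega> \<theta> \<Phi> a = exp (\<theta> * \<Phi> a) / (\<Sum>b\<in>\<Omega>. exp (\<theta> * \<Phi> b))"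

definition expected_potential :: "'s set \<Rightarrow> real \<Rightarrow> ('s \<Rightarrow> real) \<Rightarrow> real" where
  "expected_potential \<Omega> \<theta> \<Phi> = (\<Sum>a\<in>\<Omega>. stationary_dist \<Omega> \<theta> \<Phi> a * \<Phi> a)"

definition max_potential :: "'s set \<Rightarrow> ('s \<Rightarrow> real) \<Rightarrow> real" where
  "max_potential \<Omega> \<Phi> = Max (\<Phi> ` \<Omega>)"

end

theory Submission
  imports Defs
begin

text \<open>
  The Gibbs weights \<open>q\<close> satisfy \<open>- ln (q a) = ln Z - \<theta> \<Phi>(a)\<close> with \<open>Z\<close> the partition function, and
  \<open>ln Z \<ge> \<theta> \<Phi>\<^sup>*\<close>. Hence \<open>\<theta> (\<Phi>\<^sup>* - \<Phi>\<^sub>\<theta>)\<close> is at most the entropy of \<open>q\<close>, which is at most \<open>ln |\<Omega>|\<close>.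
\<close>

context
  fixes \<Omega> :: "'s set" and \<theta> :: real and \<Phi> :: "'s \<Rightarrow> real"
  assumes fin: "finite \<Omega>" and ne: "\<Omega> \<noteq> {}"
begin

lemma partition_function_pos: "(\<Sum>b\<in>\<Omega>. exp (\<theta> * \<Phi> b)) > 0"
  using fin ne by (intro sum_pos) auto

lemma stationary_dist_pos: "stationary_dist \<Omega> \<theta> \<Phi> a > 0"
  unfolding stationary_dist_def using partition_function_pos by simp

lemma sum_stationary_dist: "(\<Sum>a\<in>\<Omega>. stationary_dist \<Omega> \<theta> \<Phi> a) = 1"
  unfolding stationary_dist_def sum_divide_distrib [symmetric]
  using partition_function_pos by simp

text \<open>The weights sum to 1, so the constant maximum can be moved inside the average. Both
  bounds on the gap are read off from this form: the lower one from the sign of each term, the upper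
  one from a termwise estimate.\<close>

lemma max_minus_expected_potential:
  "max_potential \<Omega> \<Phi> - expected_potential \<Omega> \<theta> \<Phi> =
     (\<Sum>a\<in>\<Omega>. stationary_dist \<Omega> \<theta> \<Phi> a * (max_potential \<Omega> \<Phi> - \<Phi> a))"
  using sum_stationary_dist
  by (simp add: expected_potential_def right_diff_distrib sum_subtractf
      flip: sum_distrib_right)

lemma expected_potential_le_max: "expected_potential \<Omega> \<theta> \<Phi> \<le> max_potential \<Omega> \<Phi>"
proof -
  have "\<Phi> a \<le> max_potential \<Omega> \<Phi>" if "a \<in> \<Omega>" for a
    using fin that by (simp add: max_potential_def)
  then have "0 \<le> (\<Sum>a\<in>\<Omega>. stationary_dist \<Omega> \<theta> \<Phi> a * (max_potential \<Omega> \<Phi> - \<Phi> a))"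
    using stationary_dist_pos by (intro sum_nonneg mult_nonneg_nonneg) (auto intro: less_imp_le)
  then show ?thesis
    using max_minus_expected_potential by simp
qed

text \<open>The term of a maximiser is one summand of the partition function, and all the other
  summands are positive.\<close>

lemma max_potential_le_ln_partition_function:
  "\<theta> * max_potential \<Omega> \<Phi> \<le> ln (\<Sum>b\<in>\<Omega>. exp (\<theta> * \<Phi> b))"
proof -
  have "max_potential \<Omega> \<Phi> \<in> \<Phi> ` \<Omega>"
    unfolding max_potential_def using fin ne by (intro Max_in) auto
  then obtain a where a: "a \<in> \<Omega>" "max_potential \<Omega> \<Phi> = \<Phi> a"
    by auto
  have "exp (\<theta> * \<Phi> a) \<le> (\<Sum>b\<in>\<Omega>. exp (\<theta> * \<Phi> b))"
    using fin a(1) by (intro member_le_sum) auto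
  then show ?thesis
    using a(2) partition_function_pos by (simp add: ln_ge_iff)
qed

text \<open>Gibbs' inequality against the uniform distribution on \<open>\<Omega>\<close>. The
  entropy is never formed as a sum of its own: its comparison with the gap and its bound by
  \<open>ln K\<close> are merged into one estimate per state.\<close>

lemma max_minus_expected_potential_le:
  "\<theta> * (max_potential \<Omega> \<Phi> - expected_potential \<Omega> \<theta> \<Phi>) \<le> ln (real (card \<Omega>))"
proof -
  define q where "q = stationary_dist \<Omega> \<theta> \<Phi>"
  define K where "K = real (card \<Omega>)"
  have K: "K > 0"
    using fin ne by (simp add: K_def card_gt_0_iff)
  have q: "q a > 0" for a
    using stationary_dist_pos by (simp add: q_def)
  \<comment> \<open>The right-hand side is affine in \<open>q a\<close>, so its sum over
    \<open>\<Omega>\<close> depends only on the total mass 1 and on the number of states.\<close>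
  have bound: "q a * (\<theta> * (max_potential \<Omega> \<Phi> - \<Phi> a)) \<le> q a * (ln K - 1) + 1 / K" for a
  proof -
    have "ln (q a) = \<theta> * \<Phi> a - ln (\<Sum>b\<in>\<Omega>. exp (\<theta> * \<Phi> b))"
      using partition_function_pos by (simp add: q_def stationary_dist_def ln_div)
    then have "\<theta> * (max_potential \<Omega> \<Phi> - \<Phi> a) \<le> - ln (q a)"
      using max_potential_le_ln_partition_function by (simp add: right_diff_distrib)
    \<comment> \<open>Splitting off \<open>ln K\<close> leaves the log-ratio of the uniform weight
      \<open>1 / K\<close> to \<open>q a\<close>. Then \<open>ln x \<le> x - 1\<close> applies at
      this ratio, with equality exactly when \<open>q a = 1 / K\<close>.\<close>
    also have "\<dots> = ln K + ln (1 / (K * q a))"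
      using K q [of a] by (simp add: ln_div ln_mult)
    also have "\<dots> \<le> ln K + (1 / (K * q a) - 1)"
      using K q [of a] by (intro add_left_mono ln_le_minus_one) simp
    finally have "q a * (\<theta> * (max_potential \<Omega> \<Phi> - \<Phi> a)) \<le> q a * (ln K + (1 / (K * q a) - 1))"
      using q [of a] by simp
    also have "\<dots> = q a * (ln K - 1) + 1 / K"
      using K q [of a] by (simp add: field_simps)
    finally show ?thesis .
  qed
  have "\<theta> * (max_potential \<Omega> \<Phi> - expected_potential \<Omega> \<theta> \<Phi>) =
      (\<Sum>a\<in>\<Omega>. q a * (\<theta> * (max_potential \<Omega> \<Phi> - \<Phi> a)))"
    by (simp add: max_minus_expected_potential q_def sum_distrib_left mult.left_commute)
  also have "\<dots> \<le> (\<Sum>a\<in>\<Omega>. q a * (ln K - 1) + 1 / K)"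
    by (intro sum_mono bound)
  \<comment> \<open>The \<open>K\<close> constant terms add up to 1, which cancels the
    \<open>- 1\<close> next to \<open>ln K\<close>.\<close>
  also have "\<dots> = (\<Sum>a\<in>\<Omega>. q a) * (ln K - 1) + K * (1 / K)"
    by (simp add: sum.distrib sum_distrib_right K_def)
  also have "\<dots> = ln K"
    using K sum_stationary_dist by (simp add: q_def)
  finally show ?thesis
    by (simp add: K_def)
qed

end

theorem theorem4:
  fixes N :: nat
    and M :: "nat \<Rightarrow> 'c set"
    and P :: "nat \<Rightarrow> real"
    and d :: "nat \<Rightarrow> nat \<Rightarrow> real"
    and \<alpha> \<theta> :: real
    and \<omega> :: "nat \<Rightarrow> 'c \<Rightarrow> real"
    and Np Ns :: "nat \<Rightarrow> nat set"
    and w :: "nat \<Rightarrow> nat \<Rightarrow> real"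
  defines "\<Omega> \<equiv> profiles N M"
    and "\<Phi> \<equiv> potential N P d \<alpha> \<omega> Np Ns w"
  assumes channels: "\<And>n. n \<in> users N \<Longrightarrow> finite (M n) \<and> M n \<noteq> {}"
    and power_pos: "\<And>n. n \<in> users N \<Longrightarrow> P n > 0"
    and power_equal: "\<And>n m. n \<in> users N \<Longrightarrow> m \<in> users N \<Longrightarrow> P n = P m"
    and distance: "\<And>n m. n \<in> users N \<Longrightarrow> m \<in> users N \<Longrightarrow> n \<noteq> m \<Longrightarrow> d m n > 0 \<and> d m n = d n m"
    and path_loss: "\<alpha> > 0"
    and physical: "undirected_graph (users N) Np"
    and social: "undirected_graph (users N) Ns"
    and ties: "\<And>n m. n \<in> users N \<Longrightarrow> m \<in> Ns n \<Longrightarrow> w n m \<in> {0..1} \<and> w n m = w m n"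
    and theta: "\<theta> > 0"
  shows "0 \<le> max_potential \<Omega> \<Phi> - expected_potential \<Omega> \<theta> \<Phi> \<and>
         max_potential \<Omega> \<Phi> - expected_potential \<Omega> \<theta> \<Phi>
           \<le> 1 / \<theta> * (\<Sum>n=1..N. ln (real (card (M n))))"
proof -
  have fin: "finite \<Omega>" and ne: "\<Omega> \<noteq> {}"
    using channels by (auto simp: \<Omega>_def profiles_def users_def PiE_eq_empty_iff intro!: finite_PiE)
  \<comment> \<open>Profiles are fixed to \<open>undefined\<close> outside the users, so
    \<open>\<Omega>\<close> has exactly as many elements as the finite product of the channel
    sets.\<close>
  have "ln (real (card \<Omega>)) = ln (\<Prod>n=1..N. real (card (M n)))"
    by (simp add: \<Omega>_def profiles_def users_def card_PiE)
  \<comment> \<open>Each \<open>M n\<close> is finite and nonempty, so every factor is positive and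
    the logarithm splits.\<close>
  also have "\<dots> = (\<Sum>n=1..N. ln (real (card (M n))))"
    using channels by (intro ln_prod) (auto simp: users_def card_gt_0_iff)
  finally have "\<theta> * (max_potential \<Omega> \<Phi> - expected_potential \<Omega> \<theta> \<Phi>)
      \<le> (\<Sum>n=1..N. ln (real (card (M n))))"
    using max_minus_expected_potential_le [OF fin ne, of \<theta> \<Phi>] by simp
  then show ?thesis
    using expected_potential_le_max [OF fin ne, of \<theta> \<Phi>] theta by (simp add: field_simps)
qed

end
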